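(* Let $\Omega=\{\mathbf{x}\in\mathbb{R}^p:\mathbf{l}\le\mathbf{x}\le\mathbf{u}\}$ be a bounded box and let $f:\mathbb{R}^p\to\mathbb{R}$ be a stepwise function over $\Omega$. Suppose that the variable-importance weights are $\mathbf{w}=(1/p,\ldots,1/p)\in\mathbb{R}^p$ and that $f$ is continuous in a neighborhood of a global optimum (a global minimizer of $f$ over $\Omega$). Then the algorithm StepDIRECT converges to the globally optimal function value of $f$ over $\Omega$; that is, when the algorithm is run without a limit on the number of function evaluations, the best function value $f_{min}$ after $k$ iterations converges to $\min_{\mathbf{x}\in\Omega}f(\mathbf{x})$ as $k\to\infty$.
   Context: Stepwise function: $f:\mathbb{R}^p\to\mathbb{R}$ is stepwise over $\Omega$ if there are a finite partition $\{\Omega_i\}_{i=1}^D$ of $\Omega$ into pairwise disjoint sets and real numbers $c_1,\ldots,c_D$ with $f(\mathbf{x})=\sum_{i=1}^D c_i\,\mathbf{I}(\mathbf{x}\in\Omega_i)$ on $\Omega$, where $\mathbf{I}$ is the indicator function. The algorithm StepDIRECT first transforms the domain linearly into the unit hyper-cube, so below $\Omega=[0,1]^p$. $\mathbf{e}_i$ is the $i$-th unit vector. At iteration $k$ the algorithm keeps a finite collection $\mathcal{P}_k$ of hyper-rectangles $\mathcal{H}_i$ dividing $\Omega$. For $\mathcal{H}_i$: $\mathbf{c}_i$ is its center, $d_i$ is the distance from $\mathbf{c}_i$ to its vertices, and $f_{\mathcal{H}_i}$ is the smallest value of $f$ found at the points sampled so far in $\mathcal{H}_i$ (centers and feasible points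 sampled by the local search). $f_{min}$ is the best function value found so far over $\Omega$, and $f_{median}$ is the median of all function values evaluated so far. Fixed constants: $\epsilon>0$, $\lambda>0$, $0<\epsilon_\sigma<1$. Local variability: with $\mathcal{N}_j=\{\mathcal{H}_i\in\mathcal{P}_k:\|\mathbf{c}_i-\mathbf{c}_j\|\le\lambda d_j\}$ and $\mathcal{N}_j^D=\{\mathcal{H}_i\in\mathcal{N}_j:f_{\mathcal{H}_i}\ne f_{\mathcal{H}_j}\}$, set $\sigma_j=\max\{|\mathcal{N}_j^D|/|\mathcal{N}_j|,\epsilon_\sigma\}\in[\epsilon_\sigma,1]$. Potentially optimal: $\mathcal{H}_j\in\mathcal{P}_k$ is potentially optimal if there is $K>0$ such that $f_{\mathcal{H}_j}-Kd_j\sigma_j\le f_{\mathcal{H}_i}-Kd_i\sigma_i$ for all $\mathcal{H}_i\in\mathcal{P}_k$, and $f_{\mathcal{H}_j}-Kd_j\sigma_j\le f_{min}-\epsilon|f_{min}-f_{median}|$. Dividing: for a hyper-rectangle with side lengths $(l_1,\ldots,l_p)$ the relative importance of coordinate $i$ is $v_i=w_il_i$, and the hyper-rectangle is divided into thirds along coordinates with the highest $v_i$. For $\mathbf{w}=(1/p,\ldots,1/p)$ this is the division rule of the original DIRECT algorithm: let $I$ be the set of coordinates of largest side length, let $\delta$ be one third of that length, and let $\mathbf{c}$ be the center; evaluate $f(\mathbf{c}\pm\delta\mathbf{e}_i)$ for $i\in I$, put $s_i=\min\{f(\mathbf{c}+\delta\mathbf{e}_i),f(\mathbf{c}-\delta\mathbf{e}_i)\}$,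 and, taking the coordinates $i\in I$ in increasing order of $s_i$, successively trisect the sub-box containing $\mathbf{c}$ along coordinate $i$, so that the points $\mathbf{c}\pm\delta\mathbf{e}_i$ become centers of the new hyper-rectangles. Initialization: evaluate $f$ at $\mathbf{c}_1=(0.5,\ldots,0.5)$ and divide $\Omega$ as follows: with $\delta=1/3$, evaluate $f(\mathbf{c}_1\pm\delta\mathbf{e}_i)$ for all $i\in\{1,\ldots,p\}$, put $s_i=\min\{f(\mathbf{c}_1+\delta\mathbf{e}_i),f(\mathbf{c}_1-\delta\mathbf{e}_i)\}$, and, taking all $p$ coordinates $i$ in increasing order of $s_i$, successively trisect the sub-box containing $\mathbf{c}_1$ along coordinate $i$, so that the points $\mathbf{c}_1\pm\delta\mathbf{e}_i$ become centers of the new hyper-rectangles, giving $\mathcal{P}_1$, the values $f_{\mathcal{H}_i}$ and $f_{min}$. Iteration $k=1,2,\ldots$ (repeated as long as the number of function evaluations does not exceed a limit $m^{max}$): determine the set $\mathcal{S}$ of all potentially optimal hyper-rectangles in $\mathcal{P}_k$. For each $\mathcal{H}_j\in\mathcal{S}$: (a) perform the local search below on $\mathcal{B}=\mathcal{H}_j$ to update $f_{\mathcal{H}_j}$; (b) divide $\mathcal{H}_j$ by the dividing rule and update the collection of hyper-rectangles; (c) evaluate $f$ at the centers of the new hyper-rectangles and update all $f_{\mathcal{H}_i}$. Then update $f_{min}$ using all values from (a) and (c), and increase $k$ by $1$. Local search on a box $\mathcal{B}$: parameters $\tau>1$, $0<\delta_{min}<\delta_{max}$, $\delta\in[\delta_{min},\delta_{max}]$,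 $t^{max}>0$, and a starting point $\mathbf{x}\in\mathcal{B}$; initialize $t=0$, $f_{min}^{\mathcal{B}}=f(\mathbf{x})$. While $t<t^{max}$: compute $f_{cur}=f(\mathbf{x})$; randomly generate a finite set $\mathcal{D}$ of search directions (either directions $\pm\mathbf{e}_i$, with coordinate $i$ taken with probability $w_i$, or random samples from the unit sphere of $\mathbb{R}^p$); choose $\mathbf{d}^*$ at random from $\mathrm{argmin}_{\mathbf{d}\in\mathcal{D}}\{f(\mathbf{x}+\delta\mathbf{d}):\mathbf{x}+\delta\mathbf{d}\in\mathcal{B}\}$ and set $f^*=f(\mathbf{x}+\delta\mathbf{d}^* )$; if $f^*<f_{min}^{\mathcal{B}}$, set $f_{min}^{\mathcal{B}}=f^*$ and record the point $\mathbf{x}+\delta\mathbf{d}^*$; if $f^*>f_{cur}$ replace $\delta$ by $\min\{\tau\delta,\delta_{max}\}$, and if $f^*<f_{cur}$ replace $\delta$ by $\max\{\delta/\tau,\delta_{min}\}$; then replace $\mathbf{x}$ by $\mathbf{x}+\delta\mathbf{d}^*$ and $t$ by $t+|\mathcal{D}|+1$. Return $f_{min}^{\mathcal{B}}$ and the corresponding point. The feasible sampled points and their function values are stored and used to update the values $f_{\mathcal{H}_i}$ of new hyper-rectangles. *)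

theory Defs
  imports "HOL-Analysis.Analysis" "HOL-Library.Multiset"
begin

section \<open>Stepwise functions\<close>

definition stepwise_on :: "(real^'p) set \<Rightarrow> (real^'p \<Rightarrow> real) \<Rightarrow> bool" where
  "stepwise_on \<Omega> f \<longleftrightarrow>
     (\<exists>(D::nat) (A :: nat \<Rightarrow> (real^'p) set) (c :: nat \<Rightarrow> real).
        (\<Union>i<D. A i) = \<Omega> \<and> disjoint_family_on A {..<D} \<and>
        (\<forall>x\<in>\<Omega>. f x = (\<Sum>i<D. c i * indicator (A i) x)))"


section \<open>Hyper-rectangles\<close>

text \<open>
  A hyper-rectangle is encoded by its lower and upper corners \<open>(a, b)\<close>; as a point set it is
  the closed box \<open>cbox a b\<close>.
\<close>

type_synonym 'p rect = "(real^'p) \<times> (real^'p)"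

definition region :: "'p::finite rect \<Rightarrow> (real^'p) set" where
  "region H = cbox (fst H) (snd H)"

definition center :: "'p::finite rect \<Rightarrow> real^'p" where
  "center H = midpoint (fst H) (snd H)"

text \<open>All vertices have the same distance from the center, so one of them suffices.\<close>

definition radius :: "'p::finite rect \<Rightarrow> real" where
  "radius H = dist (center H) (snd H)"

definition side :: "'p::finite rect \<Rightarrow> 'p \<Rightarrow> real" where
  "side H i = snd H $ i - fst H $ i"

definition unit_cube :: "'p::finite rect" where
  "unit_cube = (0, 1)"


section \<open>Parameters and states of the algorithm\<close>

text \<open>
  The initial step size and the starting point of a local search are not parameters: every
  call may choose them freely within \<open>[delta_min, delta_max]\<close> and the searched box.
\<close>

record 'p params =
  weight :: "real^'p"
  eps :: real
  lam :: real
  eps_sigma :: real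
  tau :: real
  delta_min :: real
  delta_max :: real
  t_max :: nat

text \<open>
  \<open>evals\<close> is the multiset of all points at which the objective has been evaluated, with one
  entry per evaluation.
\<close>

record 'p state =
  rects :: "'p rect set"
  evals :: "(real^'p) multiset"

definition f_rect :: "(real^'p \<Rightarrow> real) \<Rightarrow> 'p::finite state \<Rightarrow> 'p rect \<Rightarrow> real" where
  "f_rect f s H = Min (f ` (set_mset (evals s) \<inter> region H))"

definition f_min :: "(real^'p \<Rightarrow> real) \<Rightarrow> 'p::finite state \<Rightarrow> real" where
  "f_min f s = Min (f ` (set_mset (evals s) \<inter> region unit_cube))"

text \<open>For an even number of values, the median is the mean of the two middle ones.\<close>

definition median :: "real multiset \<Rightarrow> real" where
  "median M = (let xs = sorted_list_of_multiset M; n = size M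
               in (xs ! ((n - 1) div 2) + xs ! (n div 2)) / 2)"

definition f_median :: "(real^'p \<Rightarrow> real) \<Rightarrow> 'p::finite state \<Rightarrow> real" where
  "f_median f s = median (image_mset f (evals s))"


section \<open>Potentially optimal hyper-rectangles\<close>

definition neighbors :: "'p::finite params \<Rightarrow> 'p state \<Rightarrow> 'p rect \<Rightarrow> 'p rect set" where
  "neighbors prm s H = {G \<in> rects s. norm (center G - center H) \<le> lam prm * radius H}"

definition diff_neighbors ::
    "'p::finite params \<Rightarrow> (real^'p \<Rightarrow> real) \<Rightarrow> 'p state \<Rightarrow> 'p rect \<Rightarrow> 'p rect set" where
  "diff_neighbors prm f s H = {G \<in> neighbors prm s H. f_rect f s G \<noteq> f_rect f s H}"

definition variability ::
    "'p::finite params \<Rightarrow> (real^'p \<Rightarrow> real) \<Rightarrow> 'p state \<Rightarrow> 'p rect \<Rightarrow> real" where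
  "variability prm f s H =
     max (real (card (diff_neighbors prm f s H)) / real (card (neighbors prm s H)))
         (eps_sigma prm)"

definition potentially_optimal ::
    "'p::finite params \<Rightarrow> (real^'p \<Rightarrow> real) \<Rightarrow> 'p state \<Rightarrow> 'p rect \<Rightarrow> bool" where
  "potentially_optimal prm f s H \<longleftrightarrow> H \<in> rects s \<and>
     (\<exists>K>0. (\<forall>G\<in>rects s. f_rect f s H - K * radius H * variability prm f s H
                        \<le> f_rect f s G - K * radius G * variability prm f s G) \<and>
            f_rect f s H - K * radius H * variability prm f s H
              \<le> f_min f s - eps prm * \<bar>f_min f s - f_median f s\<bar>)"


section \<open>Division\<close>

definition split_coords :: "real^'p \<Rightarrow> 'p::finite rect \<Rightarrow> 'p set" where
  "split_coords w H = {i. \<forall>j. w $ j * side H j \<le> w $ i * side H i}"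

definition probe :: "'p::finite rect \<Rightarrow> 'p \<Rightarrow> real \<Rightarrow> real^'p" where
  "probe H i r = center H + (r * (side H i / 3)) *\<^sub>R axis i 1"

definition probe_value :: "(real^'p \<Rightarrow> real) \<Rightarrow> 'p::finite rect \<Rightarrow> 'p \<Rightarrow> real" where
  "probe_value f H i = min (f (probe H i 1)) (f (probe H i (- 1)))"

definition probes :: "'p::finite rect \<Rightarrow> 'p set \<Rightarrow> (real^'p) multiset" where
  "probes H I = image_mset (\<lambda>i. probe H i 1) (mset_set I) +
                image_mset (\<lambda>i. probe H i (- 1)) (mset_set I)"

text \<open>Ties are broken arbitrarily: every compatible order of the coordinates is admitted.\<close>

definition division_order ::
    "(real^'p \<Rightarrow> real) \<Rightarrow> 'p::finite rect \<Rightarrow> 'p set \<Rightarrow> 'p list \<Rightarrow> bool" where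
  "division_order f H I is \<longleftrightarrow> distinct is \<and> set is = I \<and>
     sorted_wrt (\<lambda>i j. probe_value f H i \<le> probe_value f H j) is"

definition set_coord :: "real^'p \<Rightarrow> 'p::finite \<Rightarrow> real \<Rightarrow> real^'p" where
  "set_coord x i r = (\<chi> j. if j = i then r else x $ j)"

definition lower_third :: "'p::finite rect \<Rightarrow> 'p \<Rightarrow> 'p rect" where
  "lower_third H i = (fst H, set_coord (snd H) i (fst H $ i + side H i / 3))"

definition middle_third :: "'p::finite rect \<Rightarrow> 'p \<Rightarrow> 'p rect" where
  "middle_third H i = (set_coord (fst H) i (fst H $ i + side H i / 3),
                       set_coord (snd H) i (snd H $ i - side H i / 3))"

definition upper_third :: "'p::finite rect \<Rightarrow> 'p \<Rightarrow> 'p rect" where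
  "upper_third H i = (set_coord (fst H) i (snd H $ i - side H i / 3), snd H)"

primrec subdivide :: "'p::finite rect \<Rightarrow> 'p list \<Rightarrow> 'p rect set" where
  "subdivide H [] = {H}"
| "subdivide H (i # is) =
     {lower_third H i, upper_third H i} \<union> subdivide (middle_third H i) is"


section \<open>Local search\<close>

text \<open>
  All random choices are modelled by nondeterminism: the relations below admit every
  outcome of the random generation of directions and of the random choice among minimizers.
  A coordinate direction can only be generated if its probability is positive.
\<close>

definition search_directions :: "real^'p \<Rightarrow> (real^'p::finite) set \<Rightarrow> bool" where
  "search_directions w D \<longleftrightarrow> finite D \<and>
     (D \<subseteq> {axis i r |i r. 0 < w $ i \<and> (r = 1 \<or> r = - 1)} \<or> D \<subseteq> sphere 0 1)"

definition new_step :: "'p::finite params \<Rightarrow> real \<Rightarrow> real \<Rightarrow> real \<Rightarrow> real" where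
  "new_step prm f_cur f_star \<delta> =
     (if f_star > f_cur then min (tau prm * \<delta>) (delta_max prm)
      else if f_star < f_cur then max (\<delta> / tau prm) (delta_min prm)
      else \<delta>)"

text \<open>
  \<open>search_loop prm f B x \<delta> t E\<close>: from current point \<open>x\<close>, step size \<open>\<delta>\<close> and counter \<open>t\<close>, the
  while loop on the box \<open>B\<close> can run to its end, evaluating the objective at the points \<open>E\<close>.
  The value returned by the search is the least objective value at the evaluated feasible
  points; it is not tracked separately, since \<open>f_rect\<close> and \<open>f_min\<close> are computed from all
  evaluated points.

  In \<open>stuck\<close> no generated direction is feasible, so there is no minimizer to move to.
  In \<open>move\<close> the step size is updated before the current point is; read literally the
  new step size is used for the displacement (and \<open>x\<close> may then leave \<open>B\<close>), while moving to the
  evaluated minimizer uses the old one. Both are admitted.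
\<close>

inductive search_loop ::
    "'p::finite params \<Rightarrow> (real^'p \<Rightarrow> real) \<Rightarrow> (real^'p) set \<Rightarrow>
     real^'p \<Rightarrow> real \<Rightarrow> nat \<Rightarrow> (real^'p) multiset \<Rightarrow> bool"
  for prm f B where
  stop: "search_loop prm f B x \<delta> t {#}" if "\<not> t < t_max prm"
| stuck: "search_loop prm f B x \<delta> t (add_mset x E)"
    if "t < t_max prm"
      and "search_directions (weight prm) D"
      and "\<forall>d\<in>D. x + \<delta> *\<^sub>R d \<notin> B"
      and "search_loop prm f B x \<delta> (t + card D + 1) E"
| move: "search_loop prm f B x \<delta> t
           (add_mset x (image_mset (\<lambda>d. x + \<delta> *\<^sub>R d) (mset_set {d \<in> D. x + \<delta> *\<^sub>R d \<in> B})) + E)"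
    if "t < t_max prm"
      and "search_directions (weight prm) D"
      and "is_arg_min (\<lambda>d. f (x + \<delta> *\<^sub>R d)) (\<lambda>d. d \<in> D \<and> x + \<delta> *\<^sub>R d \<in> B) d_star"
      and "\<delta>' = new_step prm (f x) (f (x + \<delta> *\<^sub>R d_star)) \<delta>"
      and "x' = x + \<delta> *\<^sub>R d_star \<or> x' = x + \<delta>' *\<^sub>R d_star"
      and "search_loop prm f B x' \<delta>' (t + card D + 1) E"

definition local_search ::
    "'p::finite params \<Rightarrow> (real^'p \<Rightarrow> real) \<Rightarrow> (real^'p) set \<Rightarrow> (real^'p) multiset \<Rightarrow> bool" where
  "local_search prm f B E \<longleftrightarrow>
     (\<exists>x\<in>B. \<exists>\<delta>\<in>{delta_min prm..delta_max prm}. \<exists>E'.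
        search_loop prm f B x \<delta> 0 E' \<and> E = add_mset x E')"


section \<open>Runs of StepDIRECT\<close>

definition initial_state :: "(real^'p \<Rightarrow> real) \<Rightarrow> 'p::finite state \<Rightarrow> bool" where
  "initial_state f s \<longleftrightarrow>
     (\<exists>is. division_order f unit_cube UNIV is \<and>
        s = \<lparr>rects = subdivide unit_cube is,
             evals = add_mset (center unit_cube) (probes unit_cube UNIV)\<rparr>)"

text \<open>
  Processing a list of hyper-rectangles one after the other. The probes of a divided
  hyper-rectangle are the centers of its new sub-rectangles; they are evaluated once, and the
  remaining sub-rectangle keeps the already evaluated center.
\<close>

inductive process ::
    "'p::finite params \<Rightarrow> (real^'p \<Rightarrow> real) \<Rightarrow> 'p state \<Rightarrow> 'p rect list \<Rightarrow> 'p state \<Rightarrow> bool"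
  for prm f where
  "process prm f s [] s"
| "process prm f s (H # Hs) s'"
    if "local_search prm f (region H) E"
      and "division_order f H (split_coords (weight prm) H) is"
      and "process prm f
             \<lparr>rects = (rects s - {H}) \<union> subdivide H is,
              evals = evals s + E + probes H (split_coords (weight prm) H)\<rparr> Hs s'"

definition iteration ::
    "'p::finite params \<Rightarrow> (real^'p \<Rightarrow> real) \<Rightarrow> 'p state \<Rightarrow> 'p state \<Rightarrow> bool" where
  "iteration prm f s s' \<longleftrightarrow>
     (\<exists>Hs. distinct Hs \<and> set Hs = {H. potentially_optimal prm f s H} \<and> process prm f s Hs s')"

text \<open>
  \<open>from_unit l u\<close> maps the unit cube onto the box \<open>cbox l u\<close>; it is the inverse of the linear
  transformation of the domain if \<open>l < u\<close> in every coordinate.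
\<close>

definition from_unit :: "real^'p \<Rightarrow> real^'p \<Rightarrow> real^'p \<Rightarrow> real^'p" where
  "from_unit l u y = (\<chi> i. l $ i + (u $ i - l $ i) * y $ i)"

text \<open>
  An infinite run on the unit cube, i.e. one without limit on the number of evaluations:
  \<open>s k\<close> is the state after \<open>k\<close> iterations.
\<close>

definition unit_run ::
    "'p::finite params \<Rightarrow> (real^'p \<Rightarrow> real) \<Rightarrow> (nat \<Rightarrow> 'p state) \<Rightarrow> bool" where
  "unit_run prm f s \<longleftrightarrow> initial_state f (s 0) \<and> (\<forall>k. iteration prm f (s k) (s (Suc k)))"

definition StepDIRECT_run ::
    "'p::finite params \<Rightarrow> (real^'p \<Rightarrow> real) \<Rightarrow> real^'p \<Rightarrow> real^'p \<Rightarrow> (nat \<Rightarrow> 'p state) \<Rightarrow> bool"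
  where
  "StepDIRECT_run prm f l u s \<longleftrightarrow> unit_run prm (f \<circ> from_unit l u) s"

definition best_value ::
    "(real^'p \<Rightarrow> real) \<Rightarrow> real^'p \<Rightarrow> real^'p \<Rightarrow> 'p::finite state \<Rightarrow> real" where
  "best_value f l u s = f_min (f \<circ> from_unit l u) s"

end

theory Submission
  imports Defs
begin

text \<open>
  Letting \<open>K\<close> tend to infinity in the definition of potential optimality shows that every iteration
  divides a hyper-rectangle that maximizes \<open>d\<^sub>j \<sigma>\<^sub>j\<close>; since \<open>\<epsilon>\<^sub>\<sigma> \<le> \<sigma>\<^sub>j \<le> 1\<close>, its radius is at least
  \<open>\<epsilon>\<^sub>\<sigma>\<close> times the largest one. With uniform weights the sides of a hyper-rectangle differ by a factor
  of at most 3, so a lower bound on the radius bounds the volume from below. The potential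
  \<open>\<Sum>\<^sub>H max 0 (A vol H - 1)\<close> never increases and drops by at least 1 whenever a hyper-rectangle with
  \<open>A vol H \<ge> 3\<close> is divided. Hence all radii tend to 0, and the centers of the hyper-rectangles
  containing the minimizer are sampled points converging to it.
\<close>

section \<open>Geometry of trisections\<close>

lemma side_lower_third: "side (lower_third H i) j = (if j = i then side H i / 3 else side H j)"
  and side_middle_third: "side (middle_third H i) j = (if j = i then side H i / 3 else side H j)"
  and side_upper_third: "side (upper_third H i) j = (if j = i then side H i / 3 else side H j)"
  by (auto simp: side_def lower_third_def middle_third_def upper_third_def set_coord_def
      field_simps)

lemmas side_thirds = side_lower_third side_middle_third side_upper_third

lemma center_nth: "center H $ i = (fst H $ i + snd H $ i) / 2"
  by (simp add: center_def midpoint_def field_simps)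

lemma center_middle_third: "center (middle_third H i) = center H"
  by (auto simp: vec_eq_iff center_nth middle_third_def set_coord_def side_def field_simps)

lemma center_lower_third: "center (lower_third H i) = probe H i (- 1)"
  and center_upper_third: "center (upper_third H i) = probe H i 1"
  by (auto simp: vec_eq_iff center_nth probe_def axis_def lower_third_def upper_third_def
      set_coord_def side_def field_simps)

text \<open>Probes evaluated for the undivided box thus stay valid after cuts along other
  coordinates.\<close>

lemma probe_middle_third: "j \<noteq> i \<Longrightarrow> probe (middle_third H i) j r = probe H j r"
  by (simp add: probe_def center_middle_third side_middle_third)

lemma mem_region: "x \<in> region H \<longleftrightarrow> (\<forall>i. fst H $ i \<le> x $ i \<and> x $ i \<le> snd H $ i)"
  by (simp add: region_def mem_box_cart)

lemma region_thirds:
  "region H \<subseteq> region (lower_third H i) \<union> region (middle_third H i) \<union> region (upper_third H i)"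
proof
  fix x assume x: "x \<in> region H"
  consider "x $ i \<le> fst H $ i + side H i / 3"
    | "fst H $ i + side H i / 3 \<le> x $ i" "x $ i \<le> snd H $ i - side H i / 3"
    | "snd H $ i - side H i / 3 \<le> x $ i"
    by linarith
  then show "x \<in> region (lower_third H i) \<union> region (middle_third H i) \<union> region (upper_third H i)"
    by cases (use x in \<open>auto simp: mem_region lower_third_def middle_third_def
        upper_third_def set_coord_def\<close>)
qed

lemma region_third_subset:
  assumes "side H i \<ge> 0" and "G \<in> {lower_third H i, middle_third H i, upper_third H i}"
  shows "region G \<subseteq> region H"
proof
  fix x assume "x \<in> region G"
  then have *: "fst G $ j \<le> x $ j" "x $ j \<le> snd G $ j" for j
    by (auto simp: mem_region)
  have "fst H $ j \<le> fst G $ j \<and> snd G $ j \<le> snd H $ j" for j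
    using assms by (auto simp: lower_third_def middle_third_def upper_third_def set_coord_def
        side_def field_simps)
  then show "x \<in> region H"
    using * by (meson mem_region order_trans)
qed

section \<open>Centers and radii of boxes\<close>

lemma center_in_region:
  assumes "\<And>i. side H i \<ge> 0"
  shows "center H \<in> region H"
  using assms by (auto simp: mem_region center_nth side_def field_simps)

lemma dist_center_le_radius:
  assumes "x \<in> region H"
  shows "dist x (center H) \<le> radius H"
proof -
  have "norm ((x - center H) $ i) \<le> norm ((center H - snd H) $ i)" for i
  proof -
    have "fst H $ i \<le> x $ i" "x $ i \<le> snd H $ i"
      using assms by (auto simp: mem_region)
    then show ?thesis
      by (simp add: center_nth abs_if field_simps)
  qed
  then show ?thesis
    unfolding radius_def dist_norm by (intro norm_le_componentwise_cart) auto
qed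

text \<open>The Euclidean norm is at most the l1 norm, and each coordinate of
  \<open>center H - snd H\<close> is half a side in absolute value.\<close>

lemma radius_le:
  fixes H :: "'p::finite rect"
  assumes "\<And>i. 0 \<le> side H i" and "\<And>i. side H i \<le> L"
  shows "radius H \<le> real CARD('p) * L / 2"
proof -
  have "radius H \<le> (\<Sum>i\<in>UNIV. \<bar>(center H - snd H) $ i\<bar>)"
    unfolding radius_def dist_norm by (rule norm_le_l1_cart)
  also have "\<dots> \<le> (\<Sum>i\<in>(UNIV::'p set). L / 2)"
  proof (rule sum_mono)
    fix i
    show "\<bar>(center H - snd H) $ i\<bar> \<le> L / 2"
      using assms(1,2)[of i] by (simp add: center_nth side_def abs_if field_simps)
  qed
  finally show ?thesis by simp
qed

lemma radius_pos:
  assumes "\<And>i. 0 < side H i"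
  shows "0 < radius H"
proof -
  have "center H $ i \<noteq> snd H $ i" for i
    using assms[of i] by (simp add: center_nth side_def)
  then show ?thesis
    by (auto simp: radius_def)
qed

section \<open>Subdivisions\<close>

lemma finite_subdivide: "finite (subdivide H is)"
  by (induction "is" arbitrary: H) auto

lemma region_subdivide: "region H \<subseteq> (\<Union>G\<in>subdivide H is. region G)"
proof (induction "is" arbitrary: H)
  case (Cons i "is")
  then show ?case
    using region_thirds[of H i] Cons[of "middle_third H i"] by fastforce
qed simp

lemma region_subdivide_subset:
  assumes "\<And>i. side H i \<ge> 0" and "G \<in> subdivide H is"
  shows "region G \<subseteq> region H"
  using assms
proof (induction "is" arbitrary: H)
  case (Cons i "is")
  show ?case
  proof (cases "G \<in> subdivide (middle_third H i) is")
    case True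
    then have "region G \<subseteq> region (middle_third H i)"
      using Cons.prems by (intro Cons.IH) (auto simp: side_thirds)
    also have "\<dots> \<subseteq> region H"
      using Cons.prems by (intro region_third_subset) auto
    finally show ?thesis .
  next
    case False
    then show ?thesis
      using Cons.prems by (intro region_third_subset[of H i]) auto
  qed
qed simp

text \<open>Middle thirds keep the center of \<open>H\<close>, and by distinctness of
  \<open>is\<close> the probes along the coordinates still to come are unchanged.\<close>

lemma center_subdivide:
  assumes "distinct is" and "G \<in> subdivide H is"
  shows "center G = center H \<or> (\<exists>i\<in>set is. center G = probe H i 1 \<or> center G = probe H i (- 1))"
  using assms
proof (induction "is" arbitrary: H)
  case (Cons i "is")
  show ?case
  proof (cases "G \<in> subdivide (middle_third H i) is")
    case True
    from Cons.IH[OF _ this] Cons.prems(1)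
    consider "center G = center H"
      | j where "j \<in> set is" "center G = probe (middle_third H i) j 1 \<or>
          center G = probe (middle_third H i) j (- 1)"
      by (auto simp: center_middle_third)
    then show ?thesis
    proof cases
      case (2 j)
      moreover have "j \<noteq> i" using 2(1) Cons.prems(1) by auto
      ultimately show ?thesis by (auto simp: probe_middle_third)
    qed simp
  next
    case False
    then show ?thesis
      using Cons.prems by (auto simp: center_lower_third center_upper_third)
  qed
qed simp

text \<open>Distinctness lets each side be cut only once, so a cut side drops from \<open>L\<close>
  to exactly \<open>L / 3\<close>. The assumption on the coordinates in \<open>is\<close> passes to
  the middle third, which carries the induction.\<close>

lemma side_subdivide_bounds:
  assumes "distinct is" and "\<And>i. i \<in> set is \<Longrightarrow> side H i = L"
    and "\<And>i. L / 3 \<le> side H i \<and> side H i \<le> L" and "L > 0" and "G \<in> subdivide H is"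
  shows "L / 3 \<le> side G i \<and> side G i \<le> L"
  using assms
proof (induction "is" arbitrary: H)
  case (Cons j "is")
  have L: "side H j = L" using Cons.prems(2)[of j] by simp
  show ?case
  proof (cases "G \<in> subdivide (middle_third H j) is")
    case True
    show ?thesis
    proof (rule Cons.IH[OF _ _ _ _ True])
      show "side (middle_third H j) i = L" if "i \<in> set is" for i
        using that Cons.prems(1,2) by (auto simp: side_thirds)
      show "L / 3 \<le> side (middle_third H j) i \<and> side (middle_third H j) i \<le> L" for i
        using Cons.prems(3)[of i] L \<open>L > 0\<close> by (auto simp: side_thirds)
    qed (use Cons.prems in auto)
  next
    case False
    then show ?thesis
      using Cons.prems(3)[of i] Cons.prems(5) L \<open>L > 0\<close> by (auto simp: side_thirds)
  qed
qed simp

section \<open>The volume potential\<close>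

definition volume :: "'p::finite rect \<Rightarrow> real" where
  "volume H = (\<Prod>i\<in>UNIV. side H i)"

text \<open>Volume is additive under trisection, so the subtracted 1 makes each cut of a large box
  lose a fixed amount. Truncation at 0 keeps the many small boxes from contributing negative
  terms.\<close>

definition excess :: "real \<Rightarrow> 'p::finite rect \<Rightarrow> real" where
  "excess A H = max 0 (A * volume H - 1)"

definition potential :: "real \<Rightarrow> 'p::finite state \<Rightarrow> real" where
  "potential A s = (\<Sum>H\<in>rects s. excess A H)"

lemma prod_third:
  fixes g h :: "'p::finite \<Rightarrow> real"
  assumes "\<And>j. h j = (if j = i then g i / 3 else g j)"
  shows "(\<Prod>j\<in>UNIV. h j) = (\<Prod>j\<in>UNIV. g j) / 3"
proof -
  have "(\<Prod>j\<in>UNIV. h j) = h i * (\<Prod>j\<in>UNIV - {i}. h j)"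
    by (rule prod.remove) auto
  also have "(\<Prod>j\<in>UNIV - {i}. h j) = (\<Prod>j\<in>UNIV - {i}. g j)"
    by (rule prod.cong) (auto simp: assms)
  also have "h i * \<dots> = (g i * (\<Prod>j\<in>UNIV - {i}. g j)) / 3"
    by (simp add: assms)
  also have "g i * (\<Prod>j\<in>UNIV - {i}. g j) = (\<Prod>j\<in>UNIV. g j)"
    by (rule prod.remove[symmetric]) auto
  finally show ?thesis .
qed

lemma volume_thirds:
  "volume (lower_third H i) = volume H / 3"
  "volume (middle_third H i) = volume H / 3"
  "volume (upper_third H i) = volume H / 3"
  unfolding volume_def by (rule prod_third[where i = i], simp add: side_thirds)+

lemma excess_nonneg: "0 \<le> excess A H"
  by (simp add: excess_def)

text \<open>The potential is a sum over a set, so equal boxes merge in a union; for nonnegative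
  terms merging can only lower the sum.\<close>

lemma sum_Un_le:
  fixes g :: "'a \<Rightarrow> real"
  assumes "finite S" "finite T" "\<And>x. 0 \<le> g x"
  shows "sum g (S \<union> T) \<le> sum g S + sum g T"
  using assms sum_Un[of S T g] sum_nonneg[of "S \<inter> T" g] by auto

lemma sum_excess_subdivide_Cons:
  "sum (excess A) (subdivide H (i # is)) \<le>
     excess A (lower_third H i) + excess A (upper_third H i) +
     sum (excess A) (subdivide (middle_third H i) is)"
proof -
  \<comment> \<open>The outer thirds coincide if side \<open>i\<close> is 0; the set then has a
    single element.\<close>
  have "sum (excess A) {lower_third H i, upper_third H i} \<le>
      excess A (lower_third H i) + excess A (upper_third H i)"
    by (cases "lower_third H i = upper_third H i") (auto simp: excess_nonneg)
  then show ?thesis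
    using sum_Un_le[of "{lower_third H i, upper_third H i}" "subdivide (middle_third H i) is"
        "excess A"] finite_subdivide[of "middle_third H i" "is"]
    by (simp add: excess_nonneg)
qed

text \<open>With \<open>V = A * volume H\<close>, the three thirds have total excess
  \<open>max 0 (V - 3)\<close>, at most \<open>max 0 (V - 1)\<close>; induction handles the further
  cuts of the middle third.\<close>

lemma sum_excess_subdivide: "sum (excess A) (subdivide H is) \<le> excess A H"
proof (induction "is" arbitrary: H)
  case (Cons i "is")
  have "excess A (lower_third H i) + excess A (upper_third H i) + excess A (middle_third H i)
      \<le> excess A H"
    by (auto simp: excess_def volume_thirds max_def)
  then show ?case
    using sum_excess_subdivide_Cons[of A H i "is"] Cons[of "middle_third H i"] by linarith
qed simp

text \<open>With \<open>V = A * volume H\<close>, the first cut lowers the total from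
  \<open>V - 1\<close> to \<open>V - 3\<close>, and later cuts cannot raise it.\<close>

lemma sum_excess_subdivide_less:
  assumes "A * volume H \<ge> 3" and "is \<noteq> []"
  shows "sum (excess A) (subdivide H is) \<le> excess A H - 1"
proof -
  obtain i js where "is": "is = i # js"
    using assms(2) by (cases "is") auto
  have "excess A (lower_third H i) + excess A (upper_third H i) + excess A (middle_third H i)
      \<le> excess A H - 1"
    using assms(1) by (auto simp: excess_def volume_thirds max_def)
  then show ?thesis
    using sum_excess_subdivide_Cons[of A H i js] sum_excess_subdivide[of A "middle_third H i" js]
    unfolding "is" by linarith
qed

section \<open>Invariants of a run\<close>

definition balanced :: "'p::finite rect \<Rightarrow> bool" where
  "balanced H \<longleftrightarrow> (\<exists>L>0. \<forall>i. L / 3 \<le> side H i \<and> side H i \<le> L)"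

lemma balanced_side_pos: "balanced H \<Longrightarrow> 0 < side H i"
  unfolding balanced_def by (meson divide_pos_pos less_le_trans zero_less_numeral)

text \<open>Only sides of greatest length are cut, and they shrink to a third, so the longest side
  of \<open>H\<close> serves as the bound for every piece.\<close>

lemma balanced_subdivide:
  assumes "balanced H" and "distinct is" and "set is = {i. \<forall>j. side H j \<le> side H i}"
    and "G \<in> subdivide H is"
  shows "balanced G"
proof -
  obtain L where L: "L > 0" "\<And>i. L / 3 \<le> side H i \<and> side H i \<le> L"
    using assms(1) by (auto simp: balanced_def)
  \<comment> \<open>The bound \<open>L\<close> need not be attained, but the induction over cuts
    requires the exact length of the sides being cut; \<open>M \<le> L\<close> preserves the lower
    bound.\<close>
  define M where "M = Max (range (side H))"
  have M_in: "M \<in> range (side H)"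
    unfolding M_def by (intro Max_in) auto
  have M_ge: "side H i \<le> M" for i
    unfolding M_def by (intro Max_ge) auto
  have M: "side H i = M" if "i \<in> set is" for i
    using that M_in M_ge[of i] assms(3) by (auto intro: antisym)
  have "0 < M"
    using M_in balanced_side_pos[OF assms(1)] by auto
  moreover have "M / 3 \<le> side H i" for i
  proof -
    have "M \<le> L" using M_in L(2) by auto
    then show ?thesis using L(2)[of i] by linarith
  qed
  ultimately show ?thesis
    using side_subdivide_bounds[OF assms(2) M _ _ assms(4)] M_ge
    unfolding balanced_def by blast
qed

text \<open>By \<open>radius_le\<close>, \<open>L \<ge> 2 * r / CARD('p)\<close>, and every side is
  at least \<open>L / 3\<close>.\<close>

lemma balanced_volume_ge:
  fixes H :: "'p::finite rect"
  assumes "balanced H" and "radius H \<ge> r" and "r > 0"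
  shows "volume H \<ge> (2 * r / (3 * real CARD('p))) ^ CARD('p)"
proof -
  obtain L where L: "L > 0" "\<And>i. L / 3 \<le> side H i \<and> side H i \<le> L"
    using assms(1) by (auto simp: balanced_def)
  have "r \<le> real CARD('p) * L / 2"
    using radius_le[of H L] balanced_side_pos[OF assms(1)] L(2) assms(2)
    by (meson less_imp_le order_trans)
  then have "2 * r / (3 * real CARD('p)) \<le> L / 3"
    by (simp add: field_simps)
  then have "2 * r / (3 * real CARD('p)) \<le> side H i" for i
    using L(2)[of i] by linarith
  then have "(\<Prod>i\<in>(UNIV::'p set). 2 * r / (3 * real CARD('p))) \<le> volume H"
    unfolding volume_def using assms(3) by (intro prod_mono) auto
  then show ?thesis by simp
qed

text \<open>Covering provides a box around the minimizer, evaluated centers provide values near it,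
  and balance ties radii to volumes.\<close>

definition valid_state :: "'p::finite state \<Rightarrow> bool" where
  "valid_state s \<longleftrightarrow> finite (rects s) \<and> region unit_cube \<subseteq> (\<Union>H\<in>rects s. region H) \<and>
     (\<forall>H\<in>rects s. balanced H \<and> region H \<subseteq> region unit_cube \<and> center H \<in># evals s)"

lemma set_probes: "finite I \<Longrightarrow>
    set_mset (probes H I) = (\<lambda>i. probe H i 1) ` I \<union> (\<lambda>i. probe H i (- 1)) ` I"
  by (simp add: probes_def)

text \<open>\<open>E\<close> stands for the points of a local search; further evaluations preserve
  that all centers have been evaluated.\<close>

lemma valid_state_divide:
  assumes "valid_state s" and "H \<in> rects s"
    and "distinct is" and is_def: "set is = {i. \<forall>j. side H j \<le> side H i}"
  shows "valid_state \<lparr>rects = (rects s - {H}) \<union> subdivide H is,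
           evals = evals s + E + probes H (set is)\<rparr>"
proof -
  have H: "balanced H" "region H \<subseteq> region unit_cube" "center H \<in># evals s"
    using assms(1,2) by (auto simp: valid_state_def)
  have "balanced G \<and> region G \<subseteq> region unit_cube \<and>
      center G \<in># evals s + E + probes H (set is)" if G: "G \<in> subdivide H is" for G
  proof (intro conjI)
    show "balanced G" by (rule balanced_subdivide[OF H(1) assms(3) is_def G])
    have "region G \<subseteq> region H"
      using balanced_side_pos[OF H(1)] G by (intro region_subdivide_subset) (auto intro: less_imp_le)
    then show "region G \<subseteq> region unit_cube" using H(2) by blast
    show "center G \<in># evals s + E + probes H (set is)"
      using center_subdivide[OF assms(3) G] H(3) by (auto simp: set_probes)
  qed
  moreover have "region unit_cube \<subseteq> (\<Union>G\<in>(rects s - {H}) \<union> subdivide H is. region G)"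
  proof -
    have "region unit_cube \<subseteq> (\<Union>G\<in>rects s. region G)"
      using assms(1) by (simp add: valid_state_def)
    also have "\<dots> \<subseteq> (\<Union>G\<in>rects s - {H}. region G) \<union> region H" by auto
    also have "\<dots> \<subseteq> (\<Union>G\<in>(rects s - {H}) \<union> subdivide H is. region G)"
      using region_subdivide[of H "is"] by auto
    finally show ?thesis .
  qed
  ultimately show ?thesis
    using assms(1) by (auto simp: valid_state_def finite_subdivide)
qed

lemma side_unit_cube: "side unit_cube i = 1"
  by (simp add: side_def unit_cube_def)

lemma valid_initial_state:
  assumes "initial_state f s"
  shows "valid_state s"
proof -
  obtain "is" where "is": "distinct is" "set is = UNIV" and
    s: "s = \<lparr>rects = subdivide unit_cube is,
             evals = add_mset (center unit_cube) (probes unit_cube UNIV)\<rparr>"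
    using assms by (auto simp: initial_state_def division_order_def)
  have "balanced unit_cube"
    unfolding balanced_def by (rule exI[of _ 1]) (simp add: side_unit_cube)
  \<comment> \<open>Initialization is treated as one division of a fictitious state: the whole cube
    with its center evaluated.\<close>
  then have "valid_state \<lparr>rects = {unit_cube}, evals = {#center unit_cube#}\<rparr>"
    by (simp add: valid_state_def)
  from valid_state_divide[OF this _ "is"(1), of unit_cube "{#}"] show ?thesis
    by (simp add: "is"(2) side_unit_cube s)
qed

lemma split_coords_uniform:
  assumes "w = (\<chi> i. 1 / real CARD('p))"
  shows "split_coords w (H :: 'p::finite rect) = {i. \<forall>j. side H j \<le> side H i}"
  by (simp add: split_coords_def assms divide_le_cancel)

text \<open>Guarantees that each division makes at least one cut, so that dividing a large box
  really lowers the potential.\<close>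

lemma longest_side_exists: "{i. \<forall>j. side H j \<le> side H i} \<noteq> {}"
proof -
  have "Max (range (side H)) \<in> range (side H)" by (intro Max_in) auto
  then obtain i where "side H i = Max (range (side H))" by (metis imageE)
  then have "side H j \<le> side H i" for j by simp
  then show ?thesis by blast
qed

lemma potential_divide:
  assumes "finite (rects s)" and "H \<in> rects s"
  shows "potential A \<lparr>rects = (rects s - {H}) \<union> subdivide H is, evals = E\<rparr> \<le>
    potential A s - (excess A H - sum (excess A) (subdivide H is))"
proof -
  have "potential A s = excess A H + sum (excess A) (rects s - {H})"
    unfolding potential_def using assms by (rule sum.remove)
  then show ?thesis
    using sum_Un_le[of "rects s - {H}" "subdivide H is" "excess A"] assms(1)
    by (simp add: potential_def finite_subdivide excess_nonneg)
qed

text \<open>No division raises the potential, so a drop caused by any one box of the list survives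
  to the end.\<close>

lemma process_invariant:
  fixes prm :: "'p::finite params"
  assumes "process prm f s Hs s'" and "weight prm = (\<chi> i. 1 / real CARD('p))"
    and "valid_state s" and "set Hs \<subseteq> rects s" and "distinct Hs"
  shows "valid_state s' \<and> potential A s' \<le> potential A s \<and>
    (\<forall>H\<in>set Hs. A * volume H \<ge> 3 \<longrightarrow> potential A s' \<le> potential A s - 1)"
  using assms(1,3-5)
proof (induction rule: process.induct)
  case (2 H E "is" s Hs s')
  let ?t = "\<lparr>rects = (rects s - {H}) \<union> subdivide H is,
              evals = evals s + E + probes H (split_coords (weight prm) H)\<rparr>"
  have "is": "distinct is" "set is = {i. \<forall>j. side H j \<le> side H i}"
      "split_coords (weight prm) H = set is"
    using 2(2) split_coords_uniform[OF assms(2), of H] by (auto simp: division_order_def)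
  have H: "H \<in> rects s" using 2 by auto
  have "valid_state ?t"
    using valid_state_divide[OF 2(5) H "is"(1,2)] by (simp add: "is"(3))
  \<comment> \<open>Distinctness keeps \<open>H\<close> out of \<open>Hs\<close>, so the boxes still
    waiting survive its removal.\<close>
  moreover have "set Hs \<subseteq> rects ?t" "distinct Hs"
    using 2(6,7) by auto
  ultimately have IH: "valid_state s' \<and> potential A s' \<le> potential A ?t \<and>
      (\<forall>H\<in>set Hs. A * volume H \<ge> 3 \<longrightarrow> potential A s' \<le> potential A ?t - 1)"
    by (rule 2(4))
  have drop: "potential A ?t \<le> potential A s - (excess A H - sum (excess A) (subdivide H is))"
    using 2(5) H by (intro potential_divide) (auto simp: valid_state_def)
  have "is \<noteq> []" using "is"(2) longest_side_exists[of H] by auto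
  then have "A * volume H \<ge> 3 \<Longrightarrow> potential A ?t \<le> potential A s - 1"
    using drop sum_excess_subdivide_less[of A H "is"] by linarith
  moreover have "potential A ?t \<le> potential A s"
    using drop sum_excess_subdivide[of A H "is"] by linarith
  ultimately show ?case using IH by force
qed simp

section \<open>Potentially optimal hyper-rectangles\<close>

lemma variability_bounds:
  assumes "finite (rects s)" and "eps_sigma prm < 1"
  shows "eps_sigma prm \<le> variability prm f s H" "variability prm f s H \<le> 1"
proof -
  have "card (diff_neighbors prm f s H) \<le> card (neighbors prm s H)"
    using assms(1) by (intro card_mono) (auto simp: diff_neighbors_def neighbors_def)
  then have "real (card (diff_neighbors prm f s H)) / real (card (neighbors prm s H)) \<le> 1"
    by (auto simp: divide_le_eq_1)
  then show "variability prm f s H \<le> 1"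
    using assms(2) by (simp add: variability_def)
qed (simp add: variability_def)

lemma linear_eventually_le:
  fixes a b x y :: real
  assumes "y < x"
  shows "\<forall>\<^sub>F K in at_top. a - K * x \<le> b - K * y"
proof -
  have "\<forall>\<^sub>F K in at_top. (a - b) / (x - y) \<le> K"
    by (rule eventually_ge_at_top)
  then show ?thesis
    by eventually_elim (use assms in \<open>simp add: field_simps\<close>)
qed

text \<open>For large \<open>K\<close> the product of radius and variability dominates, so among its
  maximizers one with least \<open>f_rect\<close> is potentially optimal. The radius bound follows
  because variability lies between \<open>eps_sigma prm\<close> and 1.\<close>

lemma exists_large_potentially_optimal:
  assumes "valid_state s" and "0 < eps_sigma prm" and "eps_sigma prm < 1" and "G \<in> rects s"
  obtains H where "potentially_optimal prm f s H" "eps_sigma prm * radius G \<le> radius H"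
proof -
  define w where "w H = radius H * variability prm f s H" for H
  have fin: "finite (rects s)" using assms(1) by (simp add: valid_state_def)
  have pos: "0 < radius H" if "H \<in> rects s" for H
    using that assms(1) by (intro radius_pos balanced_side_pos) (auto simp: valid_state_def)
  define m where "m = Max (w ` rects s)"
  have m_ge: "w H \<le> m" if "H \<in> rects s" for H
    unfolding m_def using that fin by simp
  have "m \<in> w ` rects s"
    unfolding m_def using fin assms(4) by (intro Max_in) auto
  then have ne: "{H \<in> rects s. w H = m} \<noteq> {}" by auto
  \<comment> \<open>Tie-break: among boxes with maximal \<open>w\<close> the terms in
    \<open>K\<close> cancel and only \<open>f_rect\<close> decides.\<close>
  obtain H where "is_arg_min (f_rect f s) (\<lambda>H. H \<in> {H \<in> rects s. w H = m}) H"
    using ex_is_arg_min_if_finite[OF _ ne, of "f_rect f s"] fin by auto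
  then have H: "H \<in> rects s" "w H = m"
    and min: "\<And>G. G \<in> rects s \<Longrightarrow> w G = m \<Longrightarrow> f_rect f s H \<le> f_rect f s G"
    by (auto simp: is_arg_min_linorder)
  have wG: "eps_sigma prm * radius G \<le> w G"
    using variability_bounds(1)[OF fin assms(3), of f G] pos[OF assms(4)] by (simp add: w_def mult.commute)
  have "0 < m"
    using wG m_ge[OF assms(4)] pos[OF assms(4)] assms(2) by (smt (verit) mult_pos_pos)
  have "\<forall>\<^sub>F K in at_top. f_rect f s H - K * m \<le> f_rect f s G - K * w G" if "G \<in> rects s" for G
  proof (cases "w G = m")
    case True
    then show ?thesis using min[OF that] by simp
  next
    case False
    then show ?thesis using m_ge[OF that] by (intro linear_eventually_le) auto
  qed
  then have "\<forall>\<^sub>F K in at_top. \<forall>G\<in>rects s. f_rect f s H - K * m \<le> f_rect f s G - K * w G"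
    using fin by (simp add: eventually_ball_finite)
  \<comment> \<open>The right side has slope 0 in \<open>K\<close>, so \<open>0 < m\<close> gives
    the inequality for large \<open>K\<close>.\<close>
  moreover have "\<forall>\<^sub>F K in at_top. f_rect f s H - K * m
      \<le> (f_min f s - eps prm * \<bar>f_min f s - f_median f s\<bar>) - K * 0"
    using \<open>0 < m\<close> by (rule linear_eventually_le)
  moreover have "\<forall>\<^sub>F K in at_top. (0::real) < K"
    by (rule eventually_gt_at_top)
  ultimately have "\<forall>\<^sub>F K in at_top. 0 < K \<and>
      (\<forall>G\<in>rects s. f_rect f s H - K * m \<le> f_rect f s G - K * w G) \<and>
      f_rect f s H - K * m \<le> f_min f s - eps prm * \<bar>f_min f s - f_median f s\<bar>"
    by eventually_elim simp
  then obtain K where "0 < K"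
      "\<forall>G\<in>rects s. f_rect f s H - K * w H \<le> f_rect f s G - K * w G"
      "f_rect f s H - K * w H \<le> f_min f s - eps prm * \<bar>f_min f s - f_median f s\<bar>"
    using eventually_happens'[OF trivial_limit_at_top_linorder] H(2) by blast
  then have "potentially_optimal prm f s H"
    using H(1) unfolding potentially_optimal_def w_def by (auto simp: mult.assoc)
  moreover have "w H \<le> radius H"
    using variability_bounds(2)[OF fin assms(3), of f H] pos[OF H(1)]
    by (simp add: w_def mult_left_le)
  then have "eps_sigma prm * radius G \<le> radius H"
    using wG m_ge[OF assms(4)] H(2) by linarith
  ultimately show thesis by (rule that)
qed

section \<open>Convergence\<close>

lemma unit_run_valid_potential:
  fixes prm :: "'p::finite params"
  assumes "unit_run prm f s" and "weight prm = (\<chi> i. 1 / real CARD('p))"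
  shows "valid_state (s k) \<and> potential A (s (Suc k)) \<le> potential A (s k) \<and>
    (\<forall>H. potentially_optimal prm f (s k) H \<longrightarrow> A * volume H \<ge> 3 \<longrightarrow>
       potential A (s (Suc k)) \<le> potential A (s k) - 1)"
proof -
  have step: "valid_state (s (Suc k)) \<and> potential A (s (Suc k)) \<le> potential A (s k) \<and>
    (\<forall>H. potentially_optimal prm f (s k) H \<longrightarrow> A * volume H \<ge> 3 \<longrightarrow>
       potential A (s (Suc k)) \<le> potential A (s k) - 1)" if "valid_state (s k)" for k
  proof -
    obtain Hs where "distinct Hs" and Hs: "set Hs = {H. potentially_optimal prm f (s k) H}"
      and "process prm f (s k) Hs (s (Suc k))"
      using assms(1) by (auto simp: unit_run_def iteration_def)
    moreover have "set Hs \<subseteq> rects (s k)"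
      by (auto simp: Hs potentially_optimal_def)
    ultimately show ?thesis
      using process_invariant[OF _ assms(2) that, of f Hs "s (Suc k)" A] by auto
  qed
  have "valid_state (s k)" for k
    by (induction k) (use assms(1) step in \<open>auto simp: unit_run_def intro: valid_initial_state\<close>)
  then show ?thesis using step by blast
qed

text \<open>A nonincreasing potential bounded below converges, so its decrements are eventually
  below 1, whereas a box of radius at least \<open>e\<close> forces a decrement of at least
  1.\<close>

lemma unit_run_radius_small:
  fixes prm :: "'p::finite params"
  assumes run: "unit_run prm f s" and weight: "weight prm = (\<chi> i. 1 / real CARD('p))"
    and sigma: "0 < eps_sigma prm" "eps_sigma prm < 1" and "0 < e"
  shows "\<forall>\<^sub>F k in sequentially. \<forall>H\<in>rects (s k). radius H < e"
proof -
  \<comment> \<open>\<open>v\<close> is the bound of \<open>balanced_volume_ge\<close> for radius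
    \<open>eps_sigma prm * e\<close>; \<open>A\<close> is scaled so that volume \<open>v\<close>
    meets the threshold 3.\<close>
  define v where "v = (2 * (eps_sigma prm * e) / (3 * real CARD('p))) ^ CARD('p)"
  define A where "A = 3 / v"
  have v: "v > 0" unfolding v_def using sigma(1) \<open>0 < e\<close> by simp
  note inv = unit_run_valid_potential[OF run weight, where A = A]
  have "decseq (\<lambda>k. potential A (s k))"
    using inv by (intro decseq_SucI) auto
  moreover have "0 \<le> potential A (s k)" for k
    by (simp add: potential_def sum_nonneg excess_nonneg)
  ultimately obtain l where l: "(\<lambda>k. potential A (s k)) \<longlonglongrightarrow> l"
    using decseq_convergent by metis
  have "(\<lambda>k. potential A (s k) - potential A (s (Suc k))) \<longlonglongrightarrow> l - l"
    using l LIMSEQ_Suc[OF l] by (rule tendsto_diff)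
  then have "\<forall>\<^sub>F k in sequentially. potential A (s k) - potential A (s (Suc k)) < 1"
    by (rule order_tendstoD) simp
  then show ?thesis
  proof eventually_elim
    case (elim k)
    show ?case
    proof (rule ccontr)
      assume "\<not> ?thesis"
      then obtain G where G: "G \<in> rects (s k)" "e \<le> radius G" by auto
      obtain H where H: "potentially_optimal prm f (s k) H" "eps_sigma prm * radius G \<le> radius H"
        using exists_large_potentially_optimal[OF _ sigma G(1)] inv by blast
      have "eps_sigma prm * e \<le> radius H"
        using G(2) H(2) sigma(1) mult_left_mono[of e "radius G" "eps_sigma prm"] by linarith
      moreover have "balanced H"
        using inv[of k] H(1) by (auto simp: valid_state_def potentially_optimal_def)
      ultimately have "v \<le> volume H"
        unfolding v_def using sigma(1) \<open>0 < e\<close> by (intro balanced_volume_ge) auto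
      then have "3 \<le> A * volume H"
        unfolding A_def using v by (simp add: field_simps)
      then have "potential A (s (Suc k)) \<le> potential A (s k) - 1"
        using inv[of k] H(1) by blast
      then show False using elim by linarith
    qed
  qed
qed

text \<open>The box around \<open>y\<close> may change with \<open>k\<close>, but its center is
  evaluated and eventually close to \<open>y\<close>, so continuity bounds \<open>f_min\<close> from
  above; minimality bounds it from below.\<close>

lemma unit_run_converges:
  fixes prm :: "'p::finite params"
  assumes run: "unit_run prm g s" and weight: "weight prm = (\<chi> i. 1 / real CARD('p))"
    and sigma: "0 < eps_sigma prm" "eps_sigma prm < 1"
    and y: "y \<in> region unit_cube" "isCont g y"
    and min: "\<And>x. x \<in> region unit_cube \<Longrightarrow> g y \<le> g x"
  shows "(\<lambda>k. f_min g (s k)) \<longlonglongrightarrow> g y"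
proof (rule tendstoI)
  fix e :: real assume "0 < e"
  then obtain d where d: "d > 0" "\<And>x. dist x y < d \<Longrightarrow> dist (g x) (g y) < e"
    using y(2) by (auto simp: continuous_at_eps_delta dist_norm)
  have "\<forall>\<^sub>F k in sequentially. \<forall>H\<in>rects (s k). radius H < d"
    using unit_run_radius_small[OF run weight sigma d(1)] .
  then show "\<forall>\<^sub>F k in sequentially. dist (f_min g (s k)) (g y) < e"
  proof eventually_elim
    case (elim k)
    have valid: "valid_state (s k)"
      using unit_run_valid_potential[OF run weight] by blast
    then obtain H where H: "H \<in> rects (s k)" "y \<in> region H"
      using y(1) by (auto simp: valid_state_def)
    let ?S = "set_mset (evals (s k)) \<inter> region unit_cube"
    have "balanced H" "region H \<subseteq> region unit_cube" "center H \<in># evals (s k)"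
      using valid H(1) by (auto simp: valid_state_def)
    then have c: "center H \<in> ?S"
      using center_in_region[of H] balanced_side_pos[of H] by (auto intro: less_imp_le)
    have "dist (center H) y < d"
      using dist_center_le_radius[OF H(2)] elim H(1) by (force simp: dist_commute)
    then have "g (center H) < g y + e"
      using d(2)[of "center H"] by (simp add: dist_real_def)
    moreover have "f_min g (s k) \<le> g (center H)"
      unfolding f_min_def using c by (intro Min_le) auto
    \<comment> \<open>\<open>f_min\<close> ranges only over evaluated points in the cube, so
      minimality of \<open>y\<close> applies even if a local search has left it; \<open>c\<close>
      shows that the set is nonempty.\<close>
    moreover have "g y \<le> f_min g (s k)"
      unfolding f_min_def using c min by (subst Min_ge_iff) auto
    ultimately show ?case by (simp add: dist_real_def)
  qed
qed

section \<open>The affine map from the unit cube onto the box\<close>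

lemma from_unit_in_cbox:
  assumes "x \<in> region unit_cube" and "\<And>i. l $ i \<le> u $ i"
  shows "from_unit l u x \<in> cbox l u"
proof -
  have "l $ i \<le> l $ i + (u $ i - l $ i) * x $ i \<and> l $ i + (u $ i - l $ i) * x $ i \<le> u $ i" for i
  proof -
    have "0 \<le> x $ i" "x $ i \<le> 1"
      using assms(1) by (auto simp: mem_region unit_cube_def)
    moreover have "0 \<le> u $ i - l $ i" using assms(2)[of i] by simp
    ultimately show ?thesis
      using mult_left_le[of "x $ i" "u $ i - l $ i"] mult_nonneg_nonneg[of "u $ i - l $ i" "x $ i"]
      by auto
  qed
  then show ?thesis by (simp add: mem_box_cart from_unit_def)
qed

lemma from_unit_surj:
  assumes "x \<in> cbox l u"
  obtains y where "y \<in> region unit_cube" "from_unit l u y = x"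
proof
  \<comment> \<open>In coordinates with \<open>l $ i = u $ i\<close> the quotient is \<open>0\<close>.\<close>
  let ?y = "\<chi> i. (x $ i - l $ i) / (u $ i - l $ i)"
  have x: "l $ i \<le> x $ i" "x $ i \<le> u $ i" for i
    using assms by (auto simp: mem_box_cart)
  have "0 \<le> ?y $ i \<and> ?y $ i \<le> 1" for i
  proof (cases "l $ i = u $ i")
    case False
    then have "l $ i < u $ i" using x[of i] by linarith
    then show ?thesis using x[of i] by simp
  qed simp
  then show "?y \<in> region unit_cube"
    by (simp add: mem_region unit_cube_def)
  have "l $ i + (u $ i - l $ i) * ?y $ i = x $ i" for i
  proof (cases "l $ i = u $ i")
    case True
    then show ?thesis using x[of i] by simp
  qed simp
  then show "from_unit l u ?y = x"
    unfolding from_unit_def vec_eq_iff by simp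
qed

theorem theorem3p1:
  fixes f :: "real^'p \<Rightarrow> real"
    and l u x_opt :: "real^'p"
    and U :: "(real^'p) set"
    and prm :: "'p params"
    and s :: "nat \<Rightarrow> 'p state"
  assumes "stepwise_on (cbox l u) f"
    and "is_arg_min f (\<lambda>x. x \<in> cbox l u) x_opt"
    and "open U" "x_opt \<in> U" "continuous_on U f"
    and "weight prm = (\<chi> i. 1 / real CARD('p))"
    and "eps prm > 0" "lam prm > 0"
    and "0 < eps_sigma prm" "eps_sigma prm < 1"
    and "tau prm > 1"
    and "0 < delta_min prm" "delta_min prm < delta_max prm"
    and "t_max prm > 0"
    and "StepDIRECT_run prm f l u s"
  shows "(\<lambda>k. best_value f l u (s k)) \<longlonglongrightarrow> f x_opt"
proof -
  have opt: "x_opt \<in> cbox l u" "\<And>x. x \<in> cbox l u \<Longrightarrow> f x_opt \<le> f x"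
    using assms(2) by (auto simp: is_arg_min_linorder)
  then have lu: "l $ i \<le> u $ i" for i
    by (meson mem_box_cart(2) order_trans)
  \<comment> \<open>Any preimage of \<open>x_opt\<close> minimizes the transformed objective, also
    when the box is flat in some coordinates and the preimage is not unique.\<close>
  obtain y where y: "y \<in> region unit_cube" "from_unit l u y = x_opt"
    using from_unit_surj[OF opt(1)] .
  have "isCont (from_unit l u) y"
    unfolding from_unit_def isCont_def by (intro tendsto_vec_lambda tendsto_intros)
  moreover have "isCont f (from_unit l u y)"
    using assms(3-5) y(2) by (simp add: continuous_on_eq_continuous_at)
  ultimately have "isCont (f \<circ> from_unit l u) y"
    by (rule continuous_at_compose)
  moreover have "unit_run prm (f \<circ> from_unit l u) s"
    using assms(15) by (simp add: StepDIRECT_run_def)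
  moreover have "(f \<circ> from_unit l u) y \<le> (f \<circ> from_unit l u) x" if "x \<in> region unit_cube" for x
    using opt(2) from_unit_in_cbox[OF that lu] y(2) by simp
  ultimately have "(\<lambda>k. f_min (f \<circ> from_unit l u) (s k)) \<longlonglongrightarrow> (f \<circ> from_unit l u) y"
    using assms(6,9,10) y(1) by (intro unit_run_converges) auto
  then show ?thesis
    by (simp add: best_value_def y(2))
qed

end
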